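(* In the setting described in the context, define for all $A\in\mathcal{B}_{\Lambda}$ $$P^{\mathrm{post}}_{\Lambda}(A)=\int_{\mathcal{D}}\left(\int_{A\cap Q^{-1}(q)}\pi^{\mathrm{prior}}_{\Lambda}(\lambda)\,\frac{\pi^{\mathrm{obs}}_{\mathcal{D}}(Q(\lambda))}{\pi^{Q(\mathrm{prior})}_{\mathcal{D}}(Q(\lambda))}\,d\mu_{\Lambda,q}(\lambda)\right)d\mu_{\mathcal{D}}(q).$$ Then $P^{\mathrm{post}}_{\Lambda}$ is a probability measure on $(\Lambda,\mathcal{B}_{\Lambda})$ and it is a consistent solution to the stochastic inverse problem, i.e. it is absolutely continuous with respect to $\mu_{\Lambda}$ (so it admits a probability density) and $$P^{\mathrm{post}}_{\Lambda}(Q^{-1}(A))=P^{\mathrm{obs}}_{\mathcal{D}}(A)\qquad\text{for every }A\in\mathcal{B}_{\mathcal{D}}.$$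
   Context: Setting. $\Lambda\subset\mathbb{R}^n$ and $\mathcal{D}\subset\mathbb{R}^m$ are finite-dimensional metric spaces with Borel $\sigma$-algebras $\mathcal{B}_{\Lambda}$, $\mathcal{B}_{\mathcal{D}}$ and (volume) measures $\mu_{\Lambda}$, $\mu_{\mathcal{D}}$. $Q:\Lambda\to\mathcal{D}$ is a measurable map and $\mathcal{D}=Q(\Lambda)$. Assumption 1: either $\mu_{\mathcal{D}}$ is the push-forward volume measure $A\mapsto\mu_{\Lambda}(Q^{-1}(A))$, or the push-forward volume measure is absolutely continuous with respect to $\mu_{\mathcal{D}}$. The family $\{\mu_{\Lambda,q}\}_{q\in\mathcal{D}}$ is the disintegration of $\mu_{\Lambda}$ along $Q$ with respect to $\mu_{\mathcal{D}}$: each $\mu_{\Lambda,q}$ is a measure on $(\Lambda,\mathcal{B}_{\Lambda})$ with $\mu_{\Lambda,q}(\Lambda\setminus Q^{-1}(q))=0$, for each $A\in\mathcal{B}_{\Lambda}$ the map $q\mapsto\mu_{\Lambda,q}(A)$ is measurable, and $\mu_{\Lambda}(A)=\int_{\mathcal{D}}\mu_{\Lambda,q}(A\cap Q^{-1}(q))\,d\mu_{\mathcal{D}}(q)$. The prior $P^{\mathrm{prior}}_{\Lambda}$ is a probability measure on $(\Lambda,\mathcal{B}_{\Lambda})$ with density $\pi^{\mathrm{prior}}_{\Lambda}$ with respect to $\mu_{\Lambda}$. Its push-forward $P^{Q(\mathrm{prior})}_{\mathcal{D}}(A)=P^{\mathrm{prior}}_{\Lambda}(Q^{-1}(A))$ has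 density $\pi^{Q(\mathrm{prior})}_{\mathcal{D}}$ with respect to $\mu_{\mathcal{D}}$, given by $\pi^{Q(\mathrm{prior})}_{\mathcal{D}}(q)=\int_{Q^{-1}(q)}\pi^{\mathrm{prior}}_{\Lambda}(\lambda)\,d\mu_{\Lambda,q}(\lambda)$. The observed measure $P^{\mathrm{obs}}_{\mathcal{D}}$ is a probability measure on $(\mathcal{D},\mathcal{B}_{\mathcal{D}})$ with density $\pi^{\mathrm{obs}}_{\mathcal{D}}$ with respect to $\mu_{\mathcal{D}}$. Assumption 2: there is a constant $C>0$ such that $\pi^{\mathrm{obs}}_{\mathcal{D}}(q)\le C\,\pi^{Q(\mathrm{prior})}_{\mathcal{D}}(q)$ for $\mu_{\mathcal{D}}$-a.e. $q\in\mathcal{D}$. Convention: a quotient is read as $0$ at points where its denominator $\pi^{Q(\mathrm{prior})}_{\mathcal{D}}$ vanishes. Definition (stochastic inverse problem, consistency): given $P^{\mathrm{obs}}_{\mathcal{D}}$, a consistent solution is a probability measure $P_{\Lambda}$ on $(\Lambda,\mathcal{B}_{\Lambda})$, absolutely continuous with respect to $\mu_{\Lambda}$ with a probability density, such that $P_{\Lambda}(Q^{-1}(A))=P^{\mathrm{obs}}_{\mathcal{D}}(A)$ for every $A\in\mathcal{B}_{\mathcal{D}}$. *)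

theory Defs
  imports "HOL-Probability.Probability"
begin

text \<open>Densities are real-valued and nonnegative; integrals of them are taken as extended
  nonnegative integrals.\<close>

definition has_density :: "'a measure \<Rightarrow> 'a measure \<Rightarrow> ('a \<Rightarrow> real) \<Rightarrow> bool" where
  "has_density P M p \<longleftrightarrow>
     p \<in> borel_measurable M \<and> (\<forall>x\<in>space M. 0 \<le> p x) \<and> P = density M (\<lambda>x. ennreal (p x))"

text \<open>The family \<open>\<kappa>\<close> is the disintegration of \<open>M\<close> along \<open>Q\<close> with respect to \<open>N\<close>. The measures
  \<open>\<kappa> q\<close> are not assumed to be finite.\<close>

definition disintegration ::
    "'a measure \<Rightarrow> 'b measure \<Rightarrow> ('a \<Rightarrow> 'b) \<Rightarrow> ('b \<Rightarrow> 'a measure) \<Rightarrow> bool" where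
  "disintegration M N Q \<kappa> \<longleftrightarrow>
     (\<forall>q\<in>space N. sets (\<kappa> q) = sets M \<and> emeasure (\<kappa> q) (space M - Q -` {q}) = 0) \<and>
     (\<forall>A\<in>sets M. (\<lambda>q. emeasure (\<kappa> q) A) \<in> borel_measurable N) \<and>
     (\<forall>A\<in>sets M. emeasure M A = (\<integral>\<^sup>+q. emeasure (\<kappa> q) (A \<inter> Q -` {q}) \<partial>N))"

text \<open>The push-forward density of the prior may be infinite on a null set, hence its type.\<close>

definition pushforward_density ::
    "('b \<Rightarrow> 'a measure) \<Rightarrow> ('a \<Rightarrow> 'b) \<Rightarrow> ('a \<Rightarrow> real) \<Rightarrow> 'b \<Rightarrow> ennreal" where
  "pushforward_density \<kappa> Q prior q = (\<integral>\<^sup>+x\<in>Q -` {q}. ennreal (prior x) \<partial>\<kappa> q)"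

text \<open>In \<^typ>\<open>ennreal\<close> a positive number divided by zero is infinite, so the convention that a
  quotient vanishes together with its denominator has to be imposed.\<close>

definition quotient0 :: "ennreal \<Rightarrow> ennreal \<Rightarrow> ennreal" where
  "quotient0 a b = (if b = 0 then 0 else a / b)"

definition posterior ::
    "'b measure \<Rightarrow> ('b \<Rightarrow> 'a measure) \<Rightarrow> ('a \<Rightarrow> 'b) \<Rightarrow> ('a \<Rightarrow> real) \<Rightarrow> ('b \<Rightarrow> real) \<Rightarrow> 'a set \<Rightarrow> ennreal"
where
  "posterior N \<kappa> Q prior obs A =
     (\<integral>\<^sup>+q. (\<integral>\<^sup>+x\<in>A \<inter> Q -` {q}.
         ennreal (prior x) * quotient0 (ennreal (obs (Q x))) (pushforward_density \<kappa> Q prior (Q x))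
       \<partial>\<kappa> q) \<partial>N)"

text \<open>The existence of a density is required besides absolute continuity because \<open>M\<close> is not
  assumed to be \<open>\<sigma>\<close>-finite, so that the Radon-Nikodym theorem need not apply.\<close>

definition consistent_solution ::
    "'a measure \<Rightarrow> 'b measure \<Rightarrow> ('a \<Rightarrow> 'b) \<Rightarrow> 'b measure \<Rightarrow> 'a measure \<Rightarrow> bool" where
  "consistent_solution M N Q P_obs P \<longleftrightarrow>
     sets P = sets M \<and> prob_space P \<and>
     absolutely_continuous M P \<and> (\<exists>p. has_density P M p) \<and>
     (\<forall>A\<in>sets N. emeasure P (Q -` A \<inter> space M) = emeasure P_obs A)"

end

theory Submission
  imports Defs
begin

text \<open>
  Let \<open>h\<close> be the push-forward density of the prior and \<open>r\<close> the quotient of the observed density by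
  \<open>h\<close>. Since \<open>\<kappa> q\<close> charges only the fibre over \<open>q\<close>, intersecting with this fibre changes no
  integral against \<open>\<kappa> q\<close>, and the factor \<open>r (Q x)\<close> equals the constant \<open>r q\<close> there. Two facts carry
  the proof.

  First, the defining formula of a disintegration extends from sets to nonnegative functions
  (\<open>nn_integral_disintegration\<close>). Hence the iterated integral that defines the posterior is a single
  integral over \<open>M\<close>: the posterior has density \<open>\<lambda>x. prior x * r (Q x)\<close> with respect to \<open>M\<close>
  (\<open>posterior_eq_density\<close>). This yields countable additivity and absolute continuity at once. The
  density is finite everywhere, because a quotient with vanishing denominator is read as zero, and
  so it can be taken real-valued.

  Secondly, pulling the constant out of the inner integral gives mass
  \<open>\<integral>\<^sub>A r h dN\<close> to the preimage of \<open>A\<close> (\<open>posterior_vimage\<close>). It remains to see that \<open>r h\<close> is the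
  observed density almost everywhere. This can fail only where \<open>h\<close> is zero or infinite. Where \<open>h\<close>
  vanishes, the domination assumption makes the observed density vanish too. And \<open>h\<close> is finite
  almost everywhere, since its integral is the total mass of the prior
  (\<open>pushforward_density_finite\<close>). The total mass of the posterior is the case in which \<open>A\<close> is the
  whole space.
\<close>

section \<open>Integration along the fibres\<close>

text \<open>Measurability of points of \<open>N\<close> makes the fibres measurable. Without it, the null condition in
  \<^const>\<open>disintegration\<close> could hold merely because \<^const>\<open>emeasure\<close> is zero on non-measurable
  sets.\<close>

locale fibred_disintegration =
  fixes M :: "'a measure" and N :: "'b measure" and Q :: "'a \<Rightarrow> 'b" and \<kappa> :: "'b \<Rightarrow> 'a measure"
  assumes measurable_Q [measurable]: "Q \<in> measurable M N"
    and disintegration: "disintegration M N Q \<kappa>"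
    and singleton_sets: "q \<in> space N \<Longrightarrow> {q} \<in> sets N"
begin

lemma sets_kernel: "q \<in> space N \<Longrightarrow> sets (\<kappa> q) = sets M"
  using disintegration by (auto simp: disintegration_def)

lemma space_kernel: "q \<in> space N \<Longrightarrow> space (\<kappa> q) = space M"
  by (rule sets_eq_imp_space_eq) (rule sets_kernel)

lemma measurable_kernel_eq: "q \<in> space N \<Longrightarrow> measurable (\<kappa> q) L = measurable M L"
  by (rule measurable_cong_sets) (auto simp: sets_kernel)

lemma measurable_emeasure_kernel:
  "A \<in> sets M \<Longrightarrow> (\<lambda>q. emeasure (\<kappa> q) A) \<in> borel_measurable N"
  using disintegration by (auto simp: disintegration_def)

lemma AE_kernel_fibre:
  assumes q: "q \<in> space N"
  shows "AE x in \<kappa> q. Q x = q"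
proof (rule AE_I)
  show "{x \<in> space (\<kappa> q). Q x \<noteq> q} \<subseteq> space M - Q -` {q}"
    using q by (auto simp: space_kernel)
  show "emeasure (\<kappa> q) (space M - Q -` {q}) = 0"
    using disintegration q by (auto simp: disintegration_def)
  have "space M - Q -` {q} = space M - (Q -` {q} \<inter> space M)" by auto
  also have "\<dots> \<in> sets M"
    using measurable_sets[OF measurable_Q singleton_sets[OF q]] by auto
  finally show "space M - Q -` {q} \<in> sets (\<kappa> q)"
    using q by (simp add: sets_kernel)
qed

lemma nn_integral_fibre:
  assumes q: "q \<in> space N"
  shows "(\<integral>\<^sup>+x\<in>A \<inter> Q -` {q}. f x \<partial>\<kappa> q) = (\<integral>\<^sup>+x\<in>A. f x \<partial>\<kappa> q)"
  using AE_kernel_fibre[OF q] by (intro nn_integral_cong_AE) (auto split: split_indicator)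

lemma emeasure_disintegration:
  assumes A: "A \<in> sets M"
  shows "emeasure M A = (\<integral>\<^sup>+q. emeasure (\<kappa> q) A \<partial>N)"
proof -
  have "emeasure M A = (\<integral>\<^sup>+q. emeasure (\<kappa> q) (A \<inter> Q -` {q}) \<partial>N)"
    using disintegration A by (auto simp: disintegration_def)
  also have "\<dots> = (\<integral>\<^sup>+q. emeasure (\<kappa> q) A \<partial>N)"
  proof (rule nn_integral_cong)
    fix q assume q: "q \<in> space N"
    have "A \<inter> Q -` {q} = A \<inter> (Q -` {q} \<inter> space M)"
      using sets.sets_into_space[OF A] by auto
    then have "A \<inter> Q -` {q} \<in> sets M"
      using A measurable_sets[OF measurable_Q singleton_sets[OF q]] by auto
    with A q AE_kernel_fibre[OF q]
    show "emeasure (\<kappa> q) (A \<inter> Q -` {q}) = emeasure (\<kappa> q) A"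
      by (intro emeasure_eq_AE) (auto simp: sets_kernel)
  qed
  finally show ?thesis .
qed

text \<open>For indicators this is the definition of a disintegration (as \<open>\<kappa> q\<close> charges only its
  fibre), and both claims survive linear
  combinations and monotone limits. They share one induction because additivity and monotone
  convergence of the outer integral require the inner integrals to be measurable.\<close>

lemma measurable_nn_integral_disintegration:
  assumes "f \<in> borel_measurable M"
  shows "(\<lambda>q. \<integral>\<^sup>+x. f x \<partial>\<kappa> q) \<in> borel_measurable N \<and>
    (\<integral>\<^sup>+x. f x \<partial>M) = (\<integral>\<^sup>+q. (\<integral>\<^sup>+x. f x \<partial>\<kappa> q) \<partial>N)"
  using assms
proof (induction rule: borel_measurable_induct)
  case (cong f g)
  have eq: "(\<integral>\<^sup>+x. f x \<partial>\<kappa> q) = (\<integral>\<^sup>+x. g x \<partial>\<kappa> q)" if "q \<in> space N" for q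
    using cong(3) that by (intro nn_integral_cong) (auto simp: space_kernel)
  have "(\<integral>\<^sup>+x. f x \<partial>M) = (\<integral>\<^sup>+x. g x \<partial>M)"
    using cong(3) by (intro nn_integral_cong) auto
  moreover have "(\<integral>\<^sup>+q. (\<integral>\<^sup>+x. f x \<partial>\<kappa> q) \<partial>N) = (\<integral>\<^sup>+q. (\<integral>\<^sup>+x. g x \<partial>\<kappa> q) \<partial>N)"
    by (intro nn_integral_cong eq)
  ultimately show ?case
    using cong(4) measurable_cong[of N "\<lambda>q. \<integral>\<^sup>+x. f x \<partial>\<kappa> q" "\<lambda>q. \<integral>\<^sup>+x. g x \<partial>\<kappa> q", OF eq]
    by simp
next
  case (set A)
  have eq: "(\<integral>\<^sup>+x. indicator A x \<partial>\<kappa> q) = emeasure (\<kappa> q) A" if "q \<in> space N" for q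
    using set that by (simp add: sets_kernel)
  show ?case
    using measurable_emeasure_kernel[OF set] emeasure_disintegration[OF set] set
    by (simp add: eq cong: measurable_cong nn_integral_cong)
next
  case (mult u c)
  have eq: "(\<integral>\<^sup>+x. c * u x \<partial>\<kappa> q) = c * (\<integral>\<^sup>+x. u x \<partial>\<kappa> q)" if "q \<in> space N" for q
    using mult that by (intro nn_integral_cmult) (simp add: measurable_kernel_eq)
  have [measurable]: "(\<lambda>q. \<integral>\<^sup>+x. u x \<partial>\<kappa> q) \<in> borel_measurable N"
    using mult by blast
  have "(\<lambda>q. c * (\<integral>\<^sup>+x. u x \<partial>\<kappa> q)) \<in> borel_measurable N"
    by measurable
  then show ?case
    using mult
    by (simp add: eq nn_integral_cmult cong: measurable_cong nn_integral_cong)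
next
  case (add u v)
  have eq: "(\<integral>\<^sup>+x. v x + u x \<partial>\<kappa> q) = (\<integral>\<^sup>+x. v x \<partial>\<kappa> q) + (\<integral>\<^sup>+x. u x \<partial>\<kappa> q)"
    if "q \<in> space N" for q
    using add that by (intro nn_integral_add) (simp_all add: measurable_kernel_eq)
  have [measurable]: "(\<lambda>q. \<integral>\<^sup>+x. u x \<partial>\<kappa> q) \<in> borel_measurable N"
    "(\<lambda>q. \<integral>\<^sup>+x. v x \<partial>\<kappa> q) \<in> borel_measurable N"
    using add by blast+
  have "(\<lambda>q. (\<integral>\<^sup>+x. v x \<partial>\<kappa> q) + (\<integral>\<^sup>+x. u x \<partial>\<kappa> q)) \<in> borel_measurable N"
    by measurable
  then show ?case
    using add
    by (simp add: eq nn_integral_add cong: measurable_cong nn_integral_cong)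
next
  case (seq U)
  have eq: "(\<integral>\<^sup>+x. (SUP i. U i x) \<partial>\<kappa> q) = (SUP i. \<integral>\<^sup>+x. U i x \<partial>\<kappa> q)"
    if "q \<in> space N" for q
    using seq that
    by (intro nn_integral_monotone_convergence_SUP) (simp_all add: measurable_kernel_eq)
  have meas: "(\<lambda>q. \<integral>\<^sup>+x. U i x \<partial>\<kappa> q) \<in> borel_measurable N" for i
    using seq by auto
  have inc: "incseq (\<lambda>i q. \<integral>\<^sup>+x. U i x \<partial>\<kappa> q)"
    using seq(3) by (auto simp: incseq_def le_fun_def intro!: nn_integral_mono)
  have "(\<integral>\<^sup>+x. (SUP i. U i x) \<partial>M) = (SUP i. \<integral>\<^sup>+x. U i x \<partial>M)"
    using seq by (intro nn_integral_monotone_convergence_SUP) auto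
  also have "\<dots> = (SUP i. \<integral>\<^sup>+q. (\<integral>\<^sup>+x. U i x \<partial>\<kappa> q) \<partial>N)"
    using seq by auto
  also have "\<dots> = (\<integral>\<^sup>+q. (SUP i. \<integral>\<^sup>+x. U i x \<partial>\<kappa> q) \<partial>N)"
    by (rule nn_integral_monotone_convergence_SUP[symmetric, OF inc meas])
  finally have *: "(\<integral>\<^sup>+x. (SUP i. U i x) \<partial>M) = (\<integral>\<^sup>+q. (SUP i. \<integral>\<^sup>+x. U i x \<partial>\<kappa> q) \<partial>N)" .
  have "(\<lambda>q. SUP i. \<integral>\<^sup>+x. U i x \<partial>\<kappa> q) \<in> borel_measurable N"
    using meas by measurable
  with * show ?case
    by (simp add: eq image_comp cong: measurable_cong nn_integral_cong)
qed

lemmas measurable_nn_integral_kernel = measurable_nn_integral_disintegration[THEN conjunct1]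
  and nn_integral_disintegration = measurable_nn_integral_disintegration[THEN conjunct2]

section \<open>The push-forward density\<close>

lemma pushforward_density_eq:
  assumes "q \<in> space N"
  shows "pushforward_density \<kappa> Q p q = (\<integral>\<^sup>+x. ennreal (p x) \<partial>\<kappa> q)"
  using nn_integral_fibre[OF assms, of "\<lambda>x. ennreal (p x)" UNIV]
  by (simp add: pushforward_density_def)

lemma measurable_pushforward_density:
  assumes "p \<in> borel_measurable M"
  shows "pushforward_density \<kappa> Q p \<in> borel_measurable N"
  using measurable_nn_integral_kernel[of "\<lambda>x. ennreal (p x)"] assms
  by (simp add: pushforward_density_eq cong: measurable_cong)

lemma pushforward_density_finite:
  assumes [measurable]: "p \<in> borel_measurable M" and fin: "(\<integral>\<^sup>+x. ennreal (p x) \<partial>M) \<noteq> \<infinity>"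
  shows "AE q in N. pushforward_density \<kappa> Q p q \<noteq> \<infinity>"
proof (rule nn_integral_PInf_AE)
  show "pushforward_density \<kappa> Q p \<in> borel_measurable N"
    by (rule measurable_pushforward_density) fact
  show "(\<integral>\<^sup>+q. pushforward_density \<kappa> Q p q \<partial>N) \<noteq> \<infinity>"
    using fin nn_integral_disintegration[of "\<lambda>x. ennreal (p x)"]
    by (simp add: pushforward_density_eq cong: nn_integral_cong)
qed

section \<open>The posterior density and its push-forward\<close>

definition update_factor :: "('a \<Rightarrow> real) \<Rightarrow> ('b \<Rightarrow> real) \<Rightarrow> 'b \<Rightarrow> ennreal" where
  "update_factor p g q = quotient0 (ennreal (g q)) (pushforward_density \<kappa> Q p q)"

lemma measurable_update_factor:
  assumes "p \<in> borel_measurable M" and [measurable]: "g \<in> borel_measurable N"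
  shows "update_factor p g \<in> borel_measurable N"
proof -
  note [measurable] = measurable_pushforward_density[OF assms(1)]
  show ?thesis
    unfolding update_factor_def[abs_def] quotient0_def by measurable
qed

lemma update_factor_finite: "update_factor p g q < \<infinity>"
  by (simp add: update_factor_def quotient0_def less_top[symmetric] ennreal_divide_eq_top_iff)

lemma posterior_eq_density:
  assumes [measurable]: "p \<in> borel_measurable M" "g \<in> borel_measurable N" and A: "A \<in> sets M"
  shows "posterior N \<kappa> Q p g A =
    emeasure (density M (\<lambda>x. ennreal (p x) * update_factor p g (Q x))) A"
proof -
  note [measurable] = measurable_update_factor[OF assms(1,2)] A
  let ?f = "\<lambda>x. ennreal (p x) * update_factor p g (Q x)"
  have "posterior N \<kappa> Q p g A = (\<integral>\<^sup>+q. (\<integral>\<^sup>+x\<in>A. ?f x \<partial>\<kappa> q) \<partial>N)"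
    unfolding posterior_def update_factor_def by (intro nn_integral_cong nn_integral_fibre)
  also have "\<dots> = (\<integral>\<^sup>+x\<in>A. ?f x \<partial>M)"
    by (rule nn_integral_disintegration[symmetric]) measurable
  also have "\<dots> = emeasure (density M ?f) A"
    by (rule emeasure_density[symmetric]) measurable
  finally show ?thesis .
qed

text \<open>Both the factor and the indicator of \<open>Q -` A\<close> are constant on fibres, so they leave the inner
  integral, and what remains there is the push-forward density of \<open>p\<close>.\<close>

lemma posterior_vimage:
  assumes [measurable]: "p \<in> borel_measurable M" "g \<in> borel_measurable N" "A \<in> sets N"
  shows "posterior N \<kappa> Q p g (Q -` A \<inter> space M) =
    (\<integral>\<^sup>+q\<in>A. update_factor p g q * pushforward_density \<kappa> Q p q \<partial>N)"
  unfolding posterior_def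
proof (rule nn_integral_cong)
  fix q assume q: "q \<in> space N"
  have "(\<integral>\<^sup>+x\<in>(Q -` A \<inter> space M) \<inter> Q -` {q}. ennreal (p x) *
      quotient0 (ennreal (g (Q x))) (pushforward_density \<kappa> Q p (Q x)) \<partial>\<kappa> q) =
    (\<integral>\<^sup>+x. (update_factor p g q * indicator A q) * ennreal (p x) \<partial>\<kappa> q)"
    unfolding nn_integral_fibre[OF q]
  proof (rule nn_integral_cong_AE)
    show "AE x in \<kappa> q. ennreal (p x) *
        quotient0 (ennreal (g (Q x))) (pushforward_density \<kappa> Q p (Q x)) *
        indicator (Q -` A \<inter> space M) x = (update_factor p g q * indicator A q) * ennreal (p x)"
      using AE_kernel_fibre[OF q] AE_space
      by eventually_elim
        (auto simp: update_factor_def space_kernel[OF q] mult.commute split: split_indicator)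
  qed
  also have "\<dots> = (update_factor p g q * indicator A q) * (\<integral>\<^sup>+x. ennreal (p x) \<partial>\<kappa> q)"
    by (rule nn_integral_cmult) (simp add: measurable_kernel_eq[OF q])
  finally show "(\<integral>\<^sup>+x\<in>(Q -` A \<inter> space M) \<inter> Q -` {q}. ennreal (p x) *
      quotient0 (ennreal (g (Q x))) (pushforward_density \<kappa> Q p (Q x)) \<partial>\<kappa> q) =
    update_factor p g q * pushforward_density \<kappa> Q p q * indicator A q"
    by (simp add: pushforward_density_eq[OF q] ac_simps)
qed

text \<open>In the extended nonnegative reals \<open>a / h * h = a\<close> fails exactly for \<open>h = 0\<close> and \<open>h = \<infinity>\<close>
  (unless \<open>a = 0\<close>). The domination by \<open>C h\<close> settles the first case, and the finite total mass of
  \<open>p\<close> makes the second one negligible.\<close>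

lemma update_factor_mult_pushforward_density:
  assumes "p \<in> borel_measurable M" "(\<integral>\<^sup>+x. ennreal (p x) \<partial>M) \<noteq> \<infinity>"
    and dom: "AE q in N. ennreal (g q) \<le> ennreal C * pushforward_density \<kappa> Q p q"
  shows "AE q in N. update_factor p g q * pushforward_density \<kappa> Q p q = ennreal (g q)"
  using pushforward_density_finite[OF assms(1,2)] dom
proof eventually_elim
  case (elim q)
  then show ?case
    by (cases "pushforward_density \<kappa> Q p q = 0")
      (auto simp: update_factor_def quotient0_def ennreal_divide_times less_top)
qed

lemma posterior_vimage_eq_observed:
  assumes p: "p \<in> borel_measurable M" "(\<integral>\<^sup>+x. ennreal (p x) \<partial>M) \<noteq> \<infinity>"
    and obs: "has_density P_obs N g"
    and dom: "AE q in N. ennreal (g q) \<le> ennreal C * pushforward_density \<kappa> Q p q"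
    and A: "A \<in> sets N"
  shows "posterior N \<kappa> Q p g (Q -` A \<inter> space M) = emeasure P_obs A"
proof -
  from obs have g [measurable]: "g \<in> borel_measurable N"
    and P: "P_obs = density N (\<lambda>q. ennreal (g q))"
    by (auto simp: has_density_def)
  have "posterior N \<kappa> Q p g (Q -` A \<inter> space M) = (\<integral>\<^sup>+q\<in>A. ennreal (g q) \<partial>N)"
    unfolding posterior_vimage[OF p(1) g A]
    using update_factor_mult_pushforward_density[OF p dom]
    by (intro nn_integral_cong_AE) auto
  also have "\<dots> = emeasure P_obs A"
    unfolding P using A by (intro emeasure_density[symmetric]) measurable
  finally show ?thesis .
qed

end

section \<open>Consistency of the posterior\<close>

theorem theorem3p2:
  fixes \<Lambda> :: "(real ^ 'n) set" and D :: "(real ^ 'm) set"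
    and \<mu>\<^sub>\<Lambda> :: "(real ^ 'n) measure" and \<mu>\<^sub>D :: "(real ^ 'm) measure"
    and Q :: "real ^ 'n \<Rightarrow> real ^ 'm"
    and \<kappa> :: "real ^ 'm \<Rightarrow> (real ^ 'n) measure"
    and P_prior :: "(real ^ 'n) measure" and P_obs :: "(real ^ 'm) measure"
    and prior :: "real ^ 'n \<Rightarrow> real" and obs :: "real ^ 'm \<Rightarrow> real"
  assumes "sets \<mu>\<^sub>\<Lambda> = sets (restrict_space borel \<Lambda>)"
    and "sets \<mu>\<^sub>D = sets (restrict_space borel D)"
    and "Q \<in> measurable \<mu>\<^sub>\<Lambda> \<mu>\<^sub>D"
    and "D = Q ` \<Lambda>"
    and assumption1: "\<mu>\<^sub>D = distr \<mu>\<^sub>\<Lambda> \<mu>\<^sub>D Q \<or> absolutely_continuous \<mu>\<^sub>D (distr \<mu>\<^sub>\<Lambda> \<mu>\<^sub>D Q)"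
    and "disintegration \<mu>\<^sub>\<Lambda> \<mu>\<^sub>D Q \<kappa>"
    and "prob_space P_prior" and "has_density P_prior \<mu>\<^sub>\<Lambda> prior"
    and "prob_space P_obs" and "has_density P_obs \<mu>\<^sub>D obs"
    and assumption2: "\<exists>C::real. C > 0 \<and>
      (AE q in \<mu>\<^sub>D. ennreal (obs q) \<le> ennreal C * pushforward_density \<kappa> Q prior q)"
  shows "measure_space \<Lambda> (sets \<mu>\<^sub>\<Lambda>) (posterior \<mu>\<^sub>D \<kappa> Q prior obs) \<and>
    posterior \<mu>\<^sub>D \<kappa> Q prior obs \<Lambda> = 1 \<and>
    consistent_solution \<mu>\<^sub>\<Lambda> \<mu>\<^sub>D Q P_obs
           (measure_of \<Lambda> (sets \<mu>\<^sub>\<Lambda>) (posterior \<mu>\<^sub>D \<kappa> Q prior obs)) \<and>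
    (\<forall>A\<in>sets \<mu>\<^sub>D. posterior \<mu>\<^sub>D \<kappa> Q prior obs (Q -` A \<inter> \<Lambda>) = emeasure P_obs A)"
proof -
  have space_M: "space \<mu>\<^sub>\<Lambda> = \<Lambda>" and space_N: "space \<mu>\<^sub>D = D"
    using sets_eq_imp_space_eq[OF assms(1)] sets_eq_imp_space_eq[OF assms(2)]
    by (simp_all add: space_restrict_space)
  interpret fibred_disintegration \<mu>\<^sub>\<Lambda> \<mu>\<^sub>D Q \<kappa>
  proof
    fix q assume "q \<in> space \<mu>\<^sub>D"
    then have "{q} = D \<inter> {q}" by (auto simp: space_N)
    then show "{q} \<in> sets \<mu>\<^sub>D"
      unfolding assms(2) sets_restrict_space by (metis borel_singleton sets.empty_sets image_eqI)
  qed (fact assms)+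
  from \<open>has_density P_prior \<mu>\<^sub>\<Lambda> prior\<close>
  have p [measurable]: "prior \<in> borel_measurable \<mu>\<^sub>\<Lambda>"
    and P_prior: "P_prior = density \<mu>\<^sub>\<Lambda> (\<lambda>x. ennreal (prior x))"
    by (auto simp: has_density_def space_M)
  from \<open>has_density P_obs \<mu>\<^sub>D obs\<close>
  have g [measurable]: "obs \<in> borel_measurable \<mu>\<^sub>D" and sets_obs: "sets P_obs = sets \<mu>\<^sub>D"
    by (auto simp: has_density_def)
  note [measurable] = measurable_update_factor[OF p g]
  define post where "post = posterior \<mu>\<^sub>D \<kappa> Q prior obs"
  define f where "f x = ennreal (prior x) * update_factor prior obs (Q x)" for x
  have f [measurable]: "f \<in> borel_measurable \<mu>\<^sub>\<Lambda>"
    unfolding f_def[abs_def] by measurable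
  have post: "post A = emeasure (density \<mu>\<^sub>\<Lambda> f) A" if "A \<in> sets \<mu>\<^sub>\<Lambda>" for A
    unfolding post_def f_def[abs_def] by (rule posterior_eq_density[OF p g that])
  have prior_mass: "(\<integral>\<^sup>+x. ennreal (prior x) \<partial>\<mu>\<^sub>\<Lambda>) \<noteq> \<infinity>"
  proof -
    have "(\<integral>\<^sup>+x. ennreal (prior x) \<partial>\<mu>\<^sub>\<Lambda>) = emeasure P_prior (space \<mu>\<^sub>\<Lambda>)"
      unfolding P_prior by (simp add: emeasure_density cong: nn_integral_cong)
    also have "\<dots> = 1"
      using prob_space.emeasure_space_1[OF \<open>prob_space P_prior\<close>] by (simp add: P_prior)
    finally show ?thesis by simp
  qed
  from assumption2 obtain C :: real
    where "AE q in \<mu>\<^sub>D. ennreal (obs q) \<le> ennreal C * pushforward_density \<kappa> Q prior q"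
    by blast
  note post_vimage = posterior_vimage_eq_observed[OF p prior_mass \<open>has_density P_obs \<mu>\<^sub>D obs\<close> this,
      folded post_def, unfolded space_M]
  have post_total: "post \<Lambda> = 1"
  proof -
    have "post \<Lambda> = post (Q -` D \<inter> \<Lambda>)"
      using assms(4) by (intro arg_cong[where f = post]) auto
    also have "\<dots> = emeasure P_obs (space P_obs)"
      using post_vimage[OF sets.top] sets_eq_imp_space_eq[OF sets_obs] by (simp add: space_N)
    finally show ?thesis
      using prob_space.emeasure_space_1[OF \<open>prob_space P_obs\<close>] by simp
  qed
  have sigma: "sigma_sets \<Lambda> (sets \<mu>\<^sub>\<Lambda>) = sets \<mu>\<^sub>\<Lambda>"
    using sets.sigma_sets_eq[of \<mu>\<^sub>\<Lambda>] by (simp add: space_M)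
  have sub: "sets \<mu>\<^sub>\<Lambda> \<subseteq> Pow \<Lambda>"
    using sets.space_closed[of \<mu>\<^sub>\<Lambda>] by (simp add: space_M)
  have "measure_space \<Lambda> (sets \<mu>\<^sub>\<Lambda>) (emeasure (density \<mu>\<^sub>\<Lambda> f))"
    using measure_space[of "density \<mu>\<^sub>\<Lambda> f"] by (simp add: space_M)
  then have measure: "measure_space \<Lambda> (sets \<mu>\<^sub>\<Lambda>) post"
    using measure_space_eq[OF sub, of post "emeasure (density \<mu>\<^sub>\<Lambda> f)"] post by (simp add: sigma)
  have post_measure: "measure_of \<Lambda> (sets \<mu>\<^sub>\<Lambda>) post = density \<mu>\<^sub>\<Lambda> f"
  proof -
    have "measure_of \<Lambda> (sets \<mu>\<^sub>\<Lambda>) post = measure_of \<Lambda> (sets \<mu>\<^sub>\<Lambda>) (emeasure (density \<mu>\<^sub>\<Lambda> f))"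
      using post by (intro measure_of_eq[OF sub]) (simp add: sigma)
    also have "\<dots> = density \<mu>\<^sub>\<Lambda> f"
      using measure_of_of_measure[of "density \<mu>\<^sub>\<Lambda> f"] by (simp add: space_M)
    finally show ?thesis .
  qed
  have "consistent_solution \<mu>\<^sub>\<Lambda> \<mu>\<^sub>D Q P_obs (density \<mu>\<^sub>\<Lambda> f)"
    unfolding consistent_solution_def
  proof (intro conjI ballI)
    show "prob_space (density \<mu>\<^sub>\<Lambda> f)"
      using post[OF sets.top] post_total by (intro prob_spaceI) (simp add: space_M)
    show "absolutely_continuous \<mu>\<^sub>\<Lambda> (density \<mu>\<^sub>\<Lambda> f)"
      by (rule absolutely_continuousI_density) (rule f)
    \<comment> \<open>A density in the sense required is real-valued, hence the passage through \<^const>\<open>enn2real\<close>.\<close>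
    have "density \<mu>\<^sub>\<Lambda> f = density \<mu>\<^sub>\<Lambda> (\<lambda>x. ennreal (enn2real (f x)))"
      using update_factor_finite
      by (intro density_cong) (auto simp: f_def ennreal_mult_less_top ennreal_enn2real)
    then show "\<exists>p. has_density (density \<mu>\<^sub>\<Lambda> f) \<mu>\<^sub>\<Lambda> p"
      by (intro exI[of _ "\<lambda>x. enn2real (f x)"]) (simp add: has_density_def)
    fix A assume A: "A \<in> sets \<mu>\<^sub>D"
    then show "emeasure (density \<mu>\<^sub>\<Lambda> f) (Q -` A \<inter> space \<mu>\<^sub>\<Lambda>) = emeasure P_obs A"
      using post[OF measurable_sets[OF measurable_Q A]] post_vimage[OF A] by (simp add: space_M)
  qed simp
  with measure post_total post_vimage show ?thesis
    unfolding post_def[symmetric] post_measure by blast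
qed

end
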